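(* Let $\mathcal X$ be a separable infinite-dimensional (real or complex) Banach space, let $T: D(T)\subseteq\mathcal X\to\mathcal X$ be an unbounded linear operator, and let $Y_0=\bigcap_{n=1}^\infty D(T^n)$. Then $T$ is hypercyclic if and only if $T$ is relatively hypercyclic and $\overline{Y_0}=\mathcal X$. In that case, $RHC(T)=HC(T)$.
   Context: $T$ is linear on a linear subspace $D(T)$ of $\mathcal X$. Powers are defined on their natural domains: $D(T^{n+1})=\{x\in D(T^n): T^nx\in D(T)\}$. For $x\in Y_0$, $\mathrm{orb}(x,T)=\{x,Tx,T^2x,\dots\}$. Closures are taken in $\mathcal X$. $T$ is hypercyclic if there is $x\in Y_0$ with $\overline{\mathrm{orb}(x,T)}=\mathcal X$; $HC(T)$ is the set of all such $x$. $T$ is relatively hypercyclic (meaning: with respect to $Y_0$) if there is a nonzero vector $x\in Y_0$ with $\overline{\mathrm{orb}(x,T)\cap Y_0}\supseteq Y_0$; $RHC(T)$ is the set of all such $x$. *)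

theory Defs
  imports "HOL-Analysis.Analysis"
begin

(* The class banach provides a norm, completeness and a real scalar multiplication.  The
   explicit scalar multiplication treats the real case ('k = real) and the complex case
   ('k = complex) together; by the Gelfand-Mazur theorem these are, up to isomorphism, the only
   instances of real_normed_field. *)

locale banach_space_over = vector_space smul
  for smul :: "'k::real_normed_field \<Rightarrow> 'a::banach \<Rightarrow> 'a" +
  assumes smul_of_real: "smul (of_real r) x = r *\<^sub>R x"
    and norm_smul: "norm (smul c x) = norm c * norm x"

definition infinite_dimensional :: "('k::field \<Rightarrow> 'a::ab_group_add \<Rightarrow> 'a) \<Rightarrow> bool" where
  "infinite_dimensional smul \<longleftrightarrow> \<not> (\<exists>B. finite_dimensional_vector_space smul B)"

(* An operator T : D(T) -> X is a pair of the set D = D(T) and a total function T whose values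
   outside D are irrelevant. *)

locale linear_operator_on = banach_space_over smul
  for smul :: "'k::real_normed_field \<Rightarrow> 'a::banach \<Rightarrow> 'a" +
  fixes D :: "'a set" and T :: "'a \<Rightarrow> 'a"
  assumes subspace_domain: "subspace D"
    and add_on: "x \<in> D \<Longrightarrow> y \<in> D \<Longrightarrow> T (x + y) = T x + T y"
    and smul_on: "x \<in> D \<Longrightarrow> T (smul c x) = smul c (T x)"

definition bounded_operator_on :: "'a::real_normed_vector set \<Rightarrow> ('a \<Rightarrow> 'a) \<Rightarrow> bool" where
  "bounded_operator_on D T \<longleftrightarrow> (\<exists>M. \<forall>x\<in>D. norm (T x) \<le> M * norm x)"

primrec power_domain :: "'a set \<Rightarrow> ('a \<Rightarrow> 'a) \<Rightarrow> nat \<Rightarrow> 'a set" where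
  "power_domain D T 0 = UNIV"
| "power_domain D T (Suc n) = {x \<in> power_domain D T n. (T ^^ n) x \<in> D}"

definition Y0 :: "'a set \<Rightarrow> ('a \<Rightarrow> 'a) \<Rightarrow> 'a set" where
  "Y0 D T = (\<Inter>n\<in>{1..}. power_domain D T n)"

(* Only meaningful for x in Y0 D T, where no iterate leaves D. *)

definition orb :: "'a \<Rightarrow> ('a \<Rightarrow> 'a) \<Rightarrow> 'a set" where
  "orb x T = {(T ^^ n) x | n. True}"

definition HC :: "'a::topological_space set \<Rightarrow> ('a \<Rightarrow> 'a) \<Rightarrow> 'a set" where
  "HC D T = {x \<in> Y0 D T. closure (orb x T) = UNIV}"

definition hypercyclic :: "'a::topological_space set \<Rightarrow> ('a \<Rightarrow> 'a) \<Rightarrow> bool" where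
  "hypercyclic D T \<longleftrightarrow> (\<exists>x. x \<in> HC D T)"

definition RHC :: "'a::{topological_space, zero} set \<Rightarrow> ('a \<Rightarrow> 'a) \<Rightarrow> 'a set" where
  "RHC D T = {x \<in> Y0 D T. x \<noteq> 0 \<and> Y0 D T \<subseteq> closure (orb x T \<inter> Y0 D T)}"

definition relatively_hypercyclic :: "'a::{topological_space, zero} set \<Rightarrow> ('a \<Rightarrow> 'a) \<Rightarrow> bool" where
  "relatively_hypercyclic D T \<longleftrightarrow> (\<exists>x. x \<in> RHC D T)"

end

theory Submission
  imports Defs
begin

text \<open>\<open>Y0\<close> is invariant under \<open>T\<close>, so the orbit of each of its
  points lies in \<open>Y0\<close> (\<open>orb_subset_Y0\<close>). A dense orbit thus forces
  \<open>Y0\<close> to be dense; conversely, if \<open>Y0\<close> is dense, an orbit whose closure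
  contains \<open>Y0\<close> is dense in the whole space. It remains to see that a hypercyclic
  vector is nonzero: the orbit of 0 is {0}, and unboundedness of \<open>T\<close> rules out the zero
  space (\<open>HC_subset_RHC\<close>).\<close>

lemma power_domain_iff: "x \<in> power_domain D T n \<longleftrightarrow> (\<forall>k<n. (T ^^ k) x \<in> D)"
  by (induction n) (auto simp: less_Suc_eq)

text \<open>The condition on the k-th iterate is the one that the domain of the power k+1 adds, so
  the indices from 1 on give all k from 0 on.\<close>

lemma Y0_iff: "x \<in> Y0 D T \<longleftrightarrow> (\<forall>k. (T ^^ k) x \<in> D)"
  unfolding Y0_def by (force simp: power_domain_iff)

lemma orb_subset_Y0:
  assumes "x \<in> Y0 D T"
  shows "orb x T \<subseteq> Y0 D T"
proof -
  have "(T ^^ k) ((T ^^ n) x) \<in> D" for k n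
    using assms by (metis Y0_iff comp_apply funpow_add)
  then show ?thesis
    by (auto simp: Y0_iff orb_def)
qed

text \<open>By invariance the orbit equals its trace on \<open>Y0\<close>, which makes
  \<open>RHC\<close> directly comparable with \<open>HC\<close>.\<close>

lemma RHC_eq: "RHC D T = {x \<in> Y0 D T. x \<noteq> 0 \<and> Y0 D T \<subseteq> closure (orb x T)}"
  unfolding RHC_def by (auto simp: orb_subset_Y0 Int_absorb2)

lemma orb_fixed_point: "T x = x \<Longrightarrow> orb x T = {x}"
proof -
  assume "T x = x"
  then have "(T ^^ n) x = x" for n
    by (induction n) auto
  then show ?thesis
    by (auto simp: orb_def)
qed

lemma closure_Y0_of_HC:
  assumes "x \<in> HC D T"
  shows "closure (Y0 D T) = UNIV"
  using assms closure_mono[OF orb_subset_Y0[of x D T]] by (auto simp: HC_def)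

text \<open>A closed set containing the dense set \<open>Y0\<close> is the whole space.\<close>

lemma RHC_subset_HC:
  assumes "closure (Y0 D T) = UNIV"
  shows "RHC D T \<subseteq> HC D T"
  using assms closure_minimal[of "Y0 D T" "closure (orb x T)" for x]
  by (auto simp: RHC_eq HC_def)

lemma HC_subset_RHC:
  assumes "T 0 = (0 :: 'a::real_normed_vector)" and "\<not> bounded_operator_on D T"
  shows "HC D T \<subseteq> RHC D T"
proof -
  have "closure (orb 0 T) \<noteq> UNIV"
  proof
    assume "closure (orb 0 T) = UNIV"
    \<comment> \<open>\<open>T\<close> fixes 0, so the closure in question is that of {0}, which is
      {0} itself.\<close>
    then have "y = 0" for y :: 'a
      using assms(1) by (auto simp: orb_fixed_point)
    then have "bounded_operator_on D T"
      by (metis bounded_operator_on_def mult_zero_left norm_zero order_refl)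
    with assms(2) show False by simp
  qed
  then show ?thesis
    by (auto simp: HC_def RHC_eq)
qed

lemma (in linear_operator_on) map_zero: "T 0 = 0"
  using add_on[of 0 0] subspace_0[OF subspace_domain] by simp

theorem proposition2p9:
  fixes smul :: "'k::real_normed_field \<Rightarrow> 'a::banach \<Rightarrow> 'a"
    and D :: "'a set" and T :: "'a \<Rightarrow> 'a"
  assumes "separable_space (euclidean :: 'a topology)"
    and "infinite_dimensional smul"
    and "linear_operator_on smul D T"
    and "\<not> bounded_operator_on D T"
  shows "(hypercyclic D T \<longleftrightarrow> relatively_hypercyclic D T \<and> closure (Y0 D T) = UNIV) \<and>
         (hypercyclic D T \<longrightarrow> RHC D T = HC D T)"
proof -
  have "HC D T \<subseteq> RHC D T"
    using HC_subset_RHC linear_operator_on.map_zero assms(3,4) by blast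
  then show ?thesis
    unfolding hypercyclic_def relatively_hypercyclic_def
    using RHC_subset_HC[of D T] closure_Y0_of_HC[of _ D T] by blast
qed

end
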